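(* Let $n\ge1$ be an integer and let $u_{2n+1}(x,t)$ be the fundamental solution of $$\frac{\partial u}{\partial t}=(-1)^n\frac{\partial^{2n+1}u}{\partial x^{2n+1}},\quad x\in\mathbb{R},\ t>0,\qquad u(x,0)=\delta(x).$$ Then, for $x\in\mathbb{R}$ and $t>0$, $$u_{2n+1}(x,t)=-\frac{1}{\pi x}\sum_{k=1}^{\infty}\left(\frac{-x}{\sqrt[2n+1]{t}}\right)^{k}\frac{1}{k!}\,\sin\left(\frac{n\pi k}{2n+1}\right)\Gamma\left(1+\frac{k}{2n+1}\right).$$
   Context: $\delta$ is the Dirac delta at $0$ and $\Gamma$ is the Gamma function. The fundamental solution $u_{2n+1}$ is the function with Fourier transform $\int_{\mathbb{R}}e^{i\beta x}u_{2n+1}(x,t)\,dx=e^{-it\beta^{2n+1}}$; equivalently $u_{2n+1}(x,t)=\frac{1}{2\pi}\int_{\mathbb{R}}e^{-i\beta x-it\beta^{2n+1}}\,d\beta$ (a conditionally convergent oscillatory integral). At $x=0$ the right-hand side is understood as its limit as $x\to0$ (i.e. the factor $1/x$ is cancelled term by term). *)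

theory Defs
  imports "HOL-Analysis.Analysis"
begin

definition plane_wave :: "nat \<Rightarrow> real \<Rightarrow> real \<Rightarrow> real \<Rightarrow> complex" where
  "plane_wave n x t \<beta> =
     exp (- \<i> * complex_of_real (\<beta> * x) - \<i> * complex_of_real (t * \<beta> ^ (2 * n + 1)))"

text \<open>The fundamental solution of \<open>u\<^sub>t = (-1)\<^sup>n \<partial>\<^sub>x\<^bsup>2n+1\<^esup> u\<close>, \<open>u(x,0) = \<delta>(x)\<close>: the function whose
  Fourier transform \<open>\<integral> e\<^bsup>i\<beta>x\<^esup> u(x,t) dx\<close> is \<open>e\<^bsup>-it\<beta>^(2n+1)\<^esup>\<close>, given by Fourier inversion. The
  oscillatory integral is not absolutely convergent. The gauge integral over \<open>UNIV\<close> is, by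
  definition, the limit of the integrals over \<open>[a,b]\<close> as \<open>a \<rightarrow> -\<infinity>\<close> and \<open>b \<rightarrow> \<infinity>\<close> independently;
  since \<open>integral\<close> is \<open>0\<close> when this limit does not exist, convergence has to be asserted separately.\<close>

definition fundamental_solution :: "nat \<Rightarrow> real \<Rightarrow> real \<Rightarrow> complex" where
  "fundamental_solution n x t = 1 / (2 * complex_of_real pi) * integral UNIV (plane_wave n x t)"

text \<open>The link with the initial value problem: \<open>plane_wave\<close> solves the differential equation for
  each frequency \<open>\<beta>\<close> and starts from \<open>e\<^bsup>-i\<beta>x\<^esup>\<close>; formally,
  \<open>\<delta>(x) = 1/(2\<pi>) \<integral> e\<^bsup>-i\<beta>x\<^esup> d\<beta>\<close>.\<close>

lemma plane_wave_initial: "plane_wave n x 0 \<beta> = exp (- \<i> * complex_of_real (\<beta> * x))"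
  by (simp add: plane_wave_def)

lemma plane_wave_deriv_x:
  "((\<lambda>y. c * plane_wave n y t \<beta>) has_vector_derivative
      c * (- \<i> * complex_of_real \<beta>) * plane_wave n x t \<beta>) (at x)"
  unfolding plane_wave_def of_real_mult
  by (rule derivative_eq_intros has_vector_derivative_real_field refl | simp add: algebra_simps)+

lemma plane_wave_higher_deriv_x:
  "((\<lambda>f x. vector_derivative f (at x)) ^^ k) (\<lambda>y. plane_wave n y t \<beta>) =
     (\<lambda>y. (- \<i> * complex_of_real \<beta>) ^ k * plane_wave n y t \<beta>)"
proof (induction k)
  case (Suc k)
  show ?case
    unfolding funpow.simps comp_apply Suc.IH
    by (rule ext, rule vector_derivative_at[OF plane_wave_deriv_x, THEN trans]) simp
qed simp

lemma plane_wave_solves_pde: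
  "((\<lambda>s. plane_wave n x s \<beta>) has_vector_derivative
     (- 1) ^ n * ((\<lambda>f x. vector_derivative f (at x)) ^^ (2 * n + 1))
       (\<lambda>y. plane_wave n y t \<beta>) x) (at t)"
proof -
  have symbol: "(- 1) ^ n * (- \<i> * complex_of_real \<beta>) ^ (2 * n + 1)
      = - \<i> * complex_of_real \<beta> ^ (2 * n + 1)"
  proof -
    have "(- \<i> * complex_of_real \<beta>) ^ 2 = - 1 * complex_of_real \<beta> ^ 2"
      by (simp add: power_mult_distrib)
    then have "(- \<i> * complex_of_real \<beta>) ^ (2 * n) = (- 1) ^ n * complex_of_real \<beta> ^ (2 * n)"
      unfolding power_mult by (simp only: power_mult_distrib)
    moreover have "(- 1 :: complex) ^ n * (- 1) ^ n = 1"
      by (simp flip: power_mult_distrib)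
    ultimately show ?thesis
      by (simp add: power_add flip: mult.assoc)
  qed
  have "((\<lambda>s. plane_wave n x s \<beta>) has_vector_derivative
      (- \<i> * complex_of_real \<beta> ^ (2 * n + 1)) * plane_wave n x t \<beta>) (at t)"
    unfolding plane_wave_def of_real_mult of_real_power
    by (rule derivative_eq_intros has_vector_derivative_real_field refl | simp add: algebra_simps)+
  then show ?thesis
    unfolding plane_wave_higher_deriv_x mult.assoc[symmetric] symbol[unfolded mult.assoc[symmetric]]
    by simp
qed

definition series_term :: "nat \<Rightarrow> real \<Rightarrow> real \<Rightarrow> nat \<Rightarrow> real" where
  "series_term n x t k = (- x / root (2 * n + 1) t) ^ k * (1 / fact k)
     * sin (real n * pi * real k / real (2 * n + 1)) * Gamma (1 + real k / real (2 * n + 1))"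

text \<open>The index is shifted so that the sum starts at \<open>k = 1\<close>. At \<open>x = 0\<close> the expression is
  \<open>0\<close> because of \<open>1 / 0 = 0\<close>; the intended value there is the limit as \<open>x \<rightarrow> 0\<close>.\<close>

definition series_rhs :: "nat \<Rightarrow> real \<Rightarrow> real \<Rightarrow> real" where
  "series_rhs n x t = - (1 / (pi * x)) * (\<Sum>k. series_term n x t (Suc k))"

end

theory Submission
  imports Defs "HOL-Complex_Analysis.Cauchy_Integral_Theorem"
begin

text \<open>Put \<open>N = 2n+1\<close> and let \<open>F\<close> be an entire primitive of \<open>E(z) = exp (-ixz - itz\<^sup>N)\<close>. On the arc from
  \<open>R\<close> to \<open>R c\<close>, where \<open>c = e\<^bsup>-i\<pi>/(2N)\<^esup>\<close>, the integrand decays like \<open>e\<^bsup>-K\<phi>\<^esup>\<close> in the angle \<open>\<phi>\<close> with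
  \<open>K\<close> of order \<open>R\<^sup>N\<close>, so \<open>F(R) - F(R c) \<rightarrow> 0\<close>. As \<open>c\<^sup>N = -i\<close>, the integrand on the ray through \<open>c\<close> is
  \<open>exp (-ixcr - tr\<^sup>N)\<close>; expanding the first factor and integrating termwise turns each power of \<open>r\<close>
  into a Gamma value. The negative half-line contributes the complex conjugate because \<open>N\<close> is odd,
  so the whole integral is twice the real part. The resulting series is an everywhere convergent
  power series in \<open>x\<close>, whose continuity settles the case \<open>x = 0\<close>.\<close>

section \<open>Improper gauge integrals as limits over bounded intervals\<close>

lemma has_integral_UNIV_antiderivative:
  fixes F :: "real \<Rightarrow> 'a::banach"
  assumes deriv: "\<And>x. (F has_vector_derivative f x) (at x)"
    and top: "(F \<longlongrightarrow> A) at_top" and bot: "(F \<longlongrightarrow> B) at_bot"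
  shows "(f has_integral (A - B)) UNIV"
proof -
  have ftc: "(f has_integral (F b - F a)) {a..b}" if "a \<le> b" for a b
    using that by (intro fundamental_theorem_of_calculus has_vector_derivative_at_within[OF deriv])
  have intb: "f integrable_on {a..b}" for a b
    using ftc[of a b] by (cases "a \<le> b") auto
  have "\<exists>M>0. \<forall>a b. ball 0 M \<subseteq> {a..b} \<longrightarrow> norm (integral {a..b} f - (A - B)) < e"
    if e: "e > 0" for e
  proof -
    have "eventually (\<lambda>x. dist (F x) A < e/2) at_top"
      using e by (intro tendstoD[OF top]) simp
    moreover have "eventually (\<lambda>x. dist (F x) B < e/2) at_bot"
      using e by (intro tendstoD[OF bot]) simp
    ultimately obtain M1 M2 where M1: "\<And>x. x \<ge> M1 \<Longrightarrow> dist (F x) A < e/2"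
      and M2: "\<And>x. x \<le> M2 \<Longrightarrow> dist (F x) B < e/2"
      unfolding eventually_at_top_linorder eventually_at_bot_linorder by blast
    \<comment> \<open>The ball is open and misses its radius, so one unit is held in reserve: M - 1
      and -(M - 1) lie inside it and are already beyond both thresholds. The two endpoints are thus
      controlled separately, as the gauge integral over \<open>UNIV\<close> demands.\<close>
    define M where "M = max 1 (max M1 (- M2)) + 1"
    have "norm (integral {a..b} f - (A - B)) < e" if sub: "ball 0 M \<subseteq> {a..b}" for a b
    proof -
      have "M - 1 \<in> ball 0 M" "-(M - 1) \<in> ball 0 M"
        by (auto simp: M_def)
      then have *: "a \<le> -(M - 1)" "M - 1 \<le> b" using sub by auto
      then have ab: "a \<le> b" "b \<ge> M1" "a \<le> M2" by (auto simp: M_def)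
      have "integral {a..b} f - (A - B) = (F b - A) - (F a - B)"
        using ftc[OF ab(1)] by (simp add: integral_unique)
      also have "norm \<dots> < e/2 + e/2"
        using M1[OF ab(2)] M2[OF ab(3)]
        by (intro le_less_trans[OF norm_triangle_ineq4]) (simp add: dist_norm)
      finally show ?thesis by simp
    qed
    moreover have "M > 0" by (simp add: M_def)
    ultimately show ?thesis by blast
  qed
  then show ?thesis
    by (simp add: has_integral_alt'[of f] intb)
qed

text \<open>Serves the ray through c, where the integral is known to exist and the limit of the
  primitive is wanted. Symmetric intervals {-y..y} suffice: they eventually contain the required
  ball, and they meet {a..} in {a..y} once y is at least |a|.\<close>

lemma has_integral_atLeast_imp_tendsto:
  fixes f :: "real \<Rightarrow> 'a::banach"
  assumes "(f has_integral I) {a..}"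
  shows "((\<lambda>y. integral {a..y} f) \<longlongrightarrow> I) at_top"
  unfolding tendsto_iff
proof (intro allI impI)
  fix e :: real assume "e > 0"
  let ?g = "\<lambda>x. if x \<in> {a..} then f x else 0"
  obtain M where M: "\<And>u v. ball 0 M \<subseteq> {u..v} \<Longrightarrow> norm (integral {u..v} ?g - I) < e"
    using assms \<open>e > 0\<close> unfolding has_integral_alt'[of f] cbox_interval by blast
  show "eventually (\<lambda>y. dist (integral {a..y} f) I < e) at_top"
    using eventually_ge_at_top[of "max M \<bar>a\<bar>"]
  proof eventually_elim
    case (elim y)
    have "integral {a..y} f = integral {- y..y} ?g"
    proof -
      have "{- y..y} \<inter> {a..} = {a..y}" using elim by auto
      then show ?thesis
        by (simp only: integral_restrict_Int Int_commute)
    qed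
    moreover have "ball 0 M \<subseteq> {- y..y}" using elim by auto
    ultimately show ?case using M[of "- y" y] by (simp add: dist_norm)
  qed
qed

section \<open>Gamma integrals and termwise integration on the half-line\<close>

lemma has_integral_power_exp_minus_power:
  fixes t :: real and N j :: nat
  assumes "N \<ge> 1" "t > 0"
  shows "((\<lambda>r. r ^ j * exp (- t * r ^ N)) has_integral
           Gamma (real (Suc j) / N) / (N * root N t ^ Suc j)) {0..}"
proof -
  define z where "z = real (Suc j) / N"
  have z: "z > 0" using assms by (simp add: z_def)
  define f where "f = (\<lambda>s::real. s powr (z - 1) / exp s)"
  \<comment> \<open>Substitution s = t r^N in the Gamma integral at z = (j+1)/N.\<close>
  define g where "g = (\<lambda>r::real. t * r ^ N)"
  have g_bij: "bij_betw g {0<..} {0<..}"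
    by (rule bij_betwI[where g = "\<lambda>s. root N (s / t)"])
       (use assms in \<open>auto simp: g_def real_root_power_cancel\<close>)
  have "(f has_integral Gamma z) {0..}"
    unfolding f_def by (rule Gamma_integral_real[OF z])
  \<comment> \<open>The endpoint is dropped because the pointwise identity below fails there for j =
    0: the factor \<open>0 powr (z - 1)\<close> is 0, while \<open>0 ^ 0\<close> is 1. It is
    restored at the end, a single point being negligible.\<close>
  then have f: "(f has_integral Gamma z) {0<..}"
    by (rule has_integral_spike_set_eq[THEN iffD1, rotated 2])
       (auto intro: negligible_subset[of "{0}"])
  have "f absolutely_integrable_on {0<..}"
    using f by (intro nonnegative_absolutely_integrable_1) (auto simp: f_def)
  then have "(\<lambda>r. \<bar>t * (N * r ^ (N - 1))\<bar> * f (g r)) absolutely_integrable_on {0<..} \<and>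
      integral {0<..} (\<lambda>r. \<bar>t * (N * r ^ (N - 1))\<bar> * f (g r)) = Gamma z"
    using f g_bij
    by (subst has_absolute_integral_change_of_variables_1'[where g = g])
       (auto simp: g_def bij_betw_def intro!: derivative_eq_intros)
  then have "((\<lambda>r. \<bar>t * (N * r ^ (N - 1))\<bar> * f (g r)) has_integral Gamma z) {0<..}"
    by (simp add: absolutely_integrable_on_def has_integral_iff)
  then have "((\<lambda>r. (\<bar>t * (N * r ^ (N - 1))\<bar> * f (g r)) / (N * root N t ^ Suc j))
      has_integral Gamma z / (N * root N t ^ Suc j)) {0<..}"
    by (rule has_integral_divide)
  also have "?this \<longleftrightarrow> ((\<lambda>r. r ^ j * exp (- t * r ^ N)) has_integral Gamma z / (N * root N t ^ Suc j)) {0<..}"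
  proof (rule has_integral_cong)
    fix r :: real assume "r \<in> {0<..}"
    then have r: "r > 0" by simp
    have s: "g r > 0" using r assms by (simp add: g_def)
    have "(g r) powr z = (g r powr (1 / N)) powr real (Suc j)"
      by (simp add: powr_powr z_def)
    also have "\<dots> = (root N (g r)) ^ Suc j"
      using s assms by (subst powr_realpow) (auto simp: root_powr_inverse)
    also have "root N (g r) = root N t * r"
      using r assms by (simp add: g_def real_root_mult real_root_power_cancel)
    finally have powr: "(g r) powr (z - 1) = (root N t * r) ^ Suc j / (t * r ^ N)"
      using r assms by (simp add: powr_diff g_def)
    \<comment> \<open>Opaque names for the positive factors that must cancel: since r^N = q r, the
      Jacobian t N q meets the denominator t q, and only r^j and the constant N \<rho>^(j+1)
      remain.\<close>
    define q \<rho> where "q = r ^ (N - 1)" and "\<rho> = root N t"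
    have q: "q > 0" and \<rho>: "\<rho> > 0" using r assms by (simp_all add: q_def \<rho>_def)
    have "r ^ N = q * r"
      using assms unfolding q_def by (cases N) auto
    with powr have powr': "(g r) powr (z - 1) = \<rho> ^ Suc j * r ^ j / (t * q)"
      using r by (simp add: power_mult_distrib flip: \<rho>_def)
    have exp': "exp (- t * r ^ N) = 1 / exp (g r)"
      by (simp add: g_def exp_minus divide_inverse)
    show "\<bar>t * (N * r ^ (N - 1))\<bar> * f (g r) / (N * root N t ^ Suc j)
        = r ^ j * exp (- t * r ^ N)"
      unfolding f_def powr' exp' q_def[symmetric] \<rho>_def[symmetric]
      using assms q \<rho> by (simp add: abs_mult)
  qed
  finally have "((\<lambda>r. r ^ j * exp (- t * r ^ N)) has_integral Gamma z / (N * root N t ^ Suc j)) {0<..}" .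
  then show ?thesis unfolding z_def
    by (rule has_integral_spike_set_eq[THEN iffD1, rotated 2])
       (auto intro: negligible_subset[of "{0}"])
qed

text \<open>Up to M = max 1 ((a+1)/t) the linear term (a+1) r is at most (a+1) M; beyond M it is
  dominated by t r^2, hence by t r^N. Working with a + 1 instead of a buys the factor e^(-r), which
  makes the bound an integrable majorant.\<close>

lemma exp_linear_minus_power_le:
  fixes a t r :: real and N :: nat
  assumes "N \<ge> 2" "t > 0" "r \<ge> 0" "a \<ge> 0"
  shows "exp (a * r - t * r ^ N) \<le> exp ((a + 1) * max 1 ((a + 1) / t)) * exp (- r)"
proof -
  define M where "M = max 1 ((a + 1) / t)"
  have "(a + 1) * r - t * r ^ N \<le> (a + 1) * M"
  proof (cases "r \<le> M")
    case True
    have "(a + 1) * r \<le> (a + 1) * M"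
      using True assms by (intro mult_left_mono) auto
    moreover have "0 \<le> t * r ^ N" using assms by simp
    ultimately show ?thesis by linarith
  next
    case False
    then have r: "r \<ge> 1" "r \<ge> (a + 1) / t" by (auto simp: M_def)
    have "(a + 1) * r \<le> (t * r) * r"
      using r assms by (intro mult_right_mono) (auto simp: field_simps)
    also have "\<dots> = t * r ^ 2" by (simp add: power2_eq_square)
    also have "\<dots> \<le> t * r ^ N"
      using r assms by (intro mult_left_mono power_increasing) auto
    finally have "(a + 1) * r - t * r ^ N \<le> 0" by simp
    also have "0 \<le> (a + 1) * M" using assms by (simp add: M_def)
    finally show ?thesis .
  qed
  then have "a * r - t * r ^ N \<le> (a + 1) * M - r" by (simp add: algebra_simps)
  then show ?thesis unfolding M_def[symmetric] by (simp flip: exp_add)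
qed

text \<open>Dominated convergence for the partial sums of the series of e^(zr): each is bounded in
  norm by e^(|z| r), so the previous estimate with a = |z| gives one majorant for all of them.
  Integrability of the limit comes from the same theorem.\<close>

lemma exp_linear_minus_power_sums:
  fixes z :: complex and t :: real and N :: nat
  assumes "N \<ge> 2" "t > 0"
  defines "f \<equiv> \<lambda>r. exp (z * complex_of_real r - complex_of_real (t * r ^ N))"
  shows "f integrable_on {0..}"
    and "(\<lambda>j. z ^ j / fact j * complex_of_real (Gamma (real (Suc j) / N) / (N * root N t ^ Suc j)))
           sums integral {0..} f"
proof -
  define I where "I j = Gamma (real (Suc j) / N) / (N * root N t ^ Suc j)" for j
  define p where "p J r = (\<Sum>j<J. z ^ j / fact j * complex_of_real (r ^ j * exp (- t * r ^ N)))" for J r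
  define C where "C = exp ((norm z + 1) * max 1 ((norm z + 1) / t))"
  have p_int: "(p J has_integral (\<Sum>j<J. z ^ j / fact j * complex_of_real (I j))) {0..}" for J
    unfolding p_def I_def using assms
    by (intro has_integral_sum has_integral_mult_right has_integral_of_real
          has_integral_power_exp_minus_power) auto
  have dom: "(\<lambda>r. C * exp (- r)) integrable_on {0..}"
    using has_integral_exp_minus_to_infinity[of 1 0]
    by (intro integrable_on_mult_right) auto
  have p_le: "norm (p J r) \<le> C * exp (- r)" if "r \<in> {0..}" for J r
  proof -
    have r: "r \<ge> 0" using that by simp
    have "norm (p J r) \<le> (\<Sum>j<J. (norm z * r) ^ j / fact j) * exp (- t * r ^ N)"
      unfolding p_def sum_distrib_right using r
      by (intro sum_norm_le)
         (simp add: norm_mult norm_divide norm_power power_mult_distrib abs_mult)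
    also have "(\<Sum>j<J. (norm z * r) ^ j / fact j) \<le> exp (norm z * r)"
      unfolding exp_def using r summable_exp_generic[of "norm z * r"]
      by (intro order_trans[OF _ sum_le_suminf[where I = "{..<J}"]]) (auto simp: divide_inverse mult.commute)
    finally have "norm (p J r) \<le> exp (norm z * r - t * r ^ N)"
      by (simp add: mult_right_mono exp_diff exp_minus divide_inverse)
    also have "\<dots> \<le> C * exp (- r)"
      unfolding C_def using r assms by (intro exp_linear_minus_power_le) auto
    finally show ?thesis .
  qed
  have conv: "(\<lambda>J. p J r) \<longlonglongrightarrow> f r" for r
  proof -
    have "(\<lambda>j. z ^ j / fact j * complex_of_real (r ^ j * exp (- t * r ^ N))) sums
            (exp (z * complex_of_real r) * complex_of_real (exp (- t * r ^ N)))"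
      using sums_mult2[OF exp_converges[of "z * complex_of_real r"], of "complex_of_real (exp (- t * r ^ N))"]
      by (simp add: power_mult_distrib scaleR_conv_of_real field_simps)
    also have "exp (z * complex_of_real r) * complex_of_real (exp (- t * r ^ N)) = f r"
      unfolding f_def exp_diff exp_of_real by (simp add: exp_minus divide_inverse)
    finally show ?thesis by (simp add: sums_def p_def)
  qed
  have p_int': "p J integrable_on {0..}" for J
    using p_int by blast
  note dc = dominated_convergence[OF p_int' dom p_le conv]
  show "f integrable_on {0..}" by (rule dc(1))
  show "(\<lambda>j. z ^ j / fact j * complex_of_real (Gamma (real (Suc j) / N) / (N * root N t ^ Suc j)))
           sums integral {0..} f"
    using dc(2) by (simp add: sums_def integral_unique[OF p_int] I_def)
qed

section \<open>Moving from the real axis to the ray through c\<close>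

lemma sin_ge_third:
  fixes y :: real
  assumes "0 \<le> y" "y \<le> pi / 2"
  shows "y / 3 \<le> sin y"
proof -
  have y2: "y \<le> 2" using assms pi_less_4 by simp
  have "\<bar>sin y - y\<bar> \<le> y ^ 3 / 6"
    using Maclaurin_sin_bound[of y 3] assms
    by (simp add: eval_nat_numeral sin_coeff_def)
  \<comment> \<open>As y is at most 2, the error y^3/6 is at most 2y/3, which leaves y/3. This is
    the source of the factor 1/3 in K.\<close>
  moreover have "y ^ 3 \<le> 4 * y"
  proof -
    have "y ^ 3 = y ^ 2 * y" by (simp add: eval_nat_numeral)
    also have "y ^ 2 \<le> 2 ^ 2" using y2 assms by (intro power_mono)
    finally show ?thesis using assms by (simp add: mult_right_mono)
  qed
  ultimately show ?thesis by linarith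
qed

text \<open>On the arc w = R e^(-i\<phi>) the exponent has real part -x R sin \<phi> - t R^N sin
  (N\<phi>). Because N\<phi> stays within [0, pi/2], the sine bound applies and this is at most
  -K\<phi>; integrating R e^(-K\<phi>) over the arc gives less than R/K.\<close>

lemma oscillatory_primitive_arc:
  fixes x t R :: real and N :: nat and F :: "complex \<Rightarrow> complex"
  assumes N: "N \<ge> 1" and R: "R > 0"
    and F: "\<And>z. (F has_field_derivative exp (- \<i> * x * z - \<i> * t * z ^ N)) (at z)"
    and t: "t > 0" and K: "K = t * R ^ N * N / 3 - \<bar>x\<bar> * R" "K > 0"
  shows "norm (F (R * cis (- (pi / (2 * N)))) - F R) \<le> R / K"
proof -
  define w where "w \<phi> = complex_of_real R * cis (- \<phi>)" for \<phi>
  define E where "E z = exp (- \<i> * x * z - \<i> * t * z ^ N)" for z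
  define \<theta> where "\<theta> = pi / (2 * N)"
  have \<theta>: "\<theta> > 0" using N by (simp add: \<theta>_def)
  have w_deriv: "(w has_vector_derivative (- \<i> * w \<phi>)) (at \<phi>)" for \<phi>
    unfolding w_def cis_conv_exp of_real_minus
    by (rule derivative_eq_intros has_vector_derivative_real_field refl | simp add: algebra_simps)+
  have Fw: "((\<lambda>\<phi>. F (w \<phi>)) has_vector_derivative (- \<i> * w \<phi>) * E (w \<phi>)) (at \<phi>)" for \<phi>
    using field_vector_diff_chain_at[OF w_deriv F] by (simp add: o_def E_def)
  \<comment> \<open>Mean value inequality against the real majorant -(R/K) e^(-K\<phi>), whose
    derivative is R e^(-K\<phi>).\<close>
  have "norm (F (w \<theta>) - F (w 0)) \<le> - (R / K) * exp (- K * \<theta>) - - (R / K) * exp (- K * 0)"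
  proof (rule differentiable_bound_general[where f = "\<lambda>\<phi>. F (w \<phi>)" and \<phi>' = "\<lambda>\<phi>. R * exp (- K * \<phi>)"])
    show "continuous_on {0..\<theta>} (\<lambda>\<phi>. F (w \<phi>))"
      using Fw by (meson continuous_at_imp_continuous_on has_vector_derivative_continuous)
    show "continuous_on {0..\<theta>} (\<lambda>\<phi>. - (R / K) * exp (- K * \<phi>))"
      by (intro continuous_intros)
    show "((\<lambda>\<phi>. - (R / K) * exp (- K * \<phi>)) has_vector_derivative R * exp (- K * \<phi>)) (at \<phi>)" for \<phi>
      unfolding has_real_derivative_iff_has_vector_derivative[symmetric]
      using K(2) by (auto intro!: derivative_eq_intros)
    show "norm ((- \<i> * w \<phi>) * E (w \<phi>)) \<le> R * exp (- K * \<phi>)" if \<phi>: "0 < \<phi>" "\<phi> < \<theta>" for \<phi>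
    proof -
      have "w \<phi> ^ N = complex_of_real (R ^ N) * cis (- (N * \<phi>))"
        by (simp add: w_def power_mult_distrib Complex.DeMoivre)
      then have "Re (- \<i> * x * w \<phi> - \<i> * t * w \<phi> ^ N) = - x * R * sin \<phi> - t * R ^ N * sin (N * \<phi>)"
        by (simp add: w_def)
      moreover have "- x * R * sin \<phi> \<le> \<bar>x\<bar> * R * \<phi>"
      proof -
        have "- x * R * sin \<phi> \<le> \<bar>- x * R * sin \<phi>\<bar>" by (rule abs_ge_self)
        also have "\<dots> = \<bar>x\<bar> * R * \<bar>sin \<phi>\<bar>" using R by (simp add: abs_mult)
        also have "\<dots> \<le> \<bar>x\<bar> * R * \<bar>\<phi>\<bar>" using R by (intro mult_left_mono abs_sin_x_le_abs_x) auto
        finally show ?thesis using \<phi> by simp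
      qed
      moreover have "t * R ^ N * (N * \<phi> / 3) \<le> t * R ^ N * sin (N * \<phi>)"
      proof (intro mult_left_mono sin_ge_third)
        show "real N * \<phi> \<le> pi / 2" using \<phi> N by (simp add: \<theta>_def field_simps)
      qed (use \<phi> R t in auto)
      ultimately have "Re (- \<i> * x * w \<phi> - \<i> * t * w \<phi> ^ N) \<le> - K * \<phi>"
        by (simp add: K algebra_simps)
      then have "norm (E (w \<phi>)) \<le> exp (- K * \<phi>)"
        unfolding E_def norm_exp_eq_Re by simp
      moreover have "norm (- \<i> * w \<phi>) = R" using R by (simp add: w_def norm_mult)
      ultimately show ?thesis using R by (simp add: norm_mult)
    qed
  qed (use \<theta> Fw in auto)
  also have "\<dots> \<le> R / K" using K R by simp
  finally show ?thesis by (simp add: w_def \<theta>_def)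
qed

text \<open>The limit is found first along the ray, where the integrand decays exponentially, and
  then carried over to the real axis by the arc bound.\<close>

lemma oscillatory_primitive_tendsto:
  fixes x t :: real and N :: nat and F :: "complex \<Rightarrow> complex"
  assumes N: "N \<ge> 2" and t: "t > 0"
    and F: "\<And>z. (F has_field_derivative exp (- \<i> * x * z - \<i> * t * z ^ N)) (at z)"
  defines "c \<equiv> cis (- (pi / (2 * N)))"
  shows "((\<lambda>R. F (complex_of_real R) - F 0) \<longlongrightarrow>
           c * integral {0..} (\<lambda>r. exp ((- \<i> * x * c) * complex_of_real r - complex_of_real (t * r ^ N)))) at_top"
proof -
  define g where "g r = exp ((- \<i> * x * c) * complex_of_real r - complex_of_real (t * r ^ N))" for r
  have "N * (- (pi / (2 * N))) = - (pi / 2)" using N by simp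
  then have "c ^ N = cis (- (pi / 2))"
    by (simp only: c_def Complex.DeMoivre)
  then have cN: "c ^ N = - \<i>" by (simp add: complex_eq_iff)
  have ray: "((\<lambda>r. F (c * r)) has_vector_derivative c * g r) (at r)" for r :: real
  proof -
    have "((\<lambda>r. c * complex_of_real r) has_vector_derivative c) (at r)"
      by (auto intro!: derivative_eq_intros)
    from field_vector_diff_chain_at[OF this F]
    show ?thesis by (simp add: o_def g_def power_mult_distrib cN mult_ac)
  qed
  have "integral {0..R} (\<lambda>r. c * g r) = F (c * R) - F 0" if "R \<ge> 0" for R :: real
    using fundamental_theorem_of_calculus[OF that has_vector_derivative_at_within[OF ray]]
    by (simp add: integral_unique del: integral_mult_right)
  then have "eventually (\<lambda>R::real. integral {0..R} (\<lambda>r. c * g r) = F (c * R) - F 0) at_top"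
    by (rule eventually_mono[OF eventually_ge_at_top[of 0]])
  moreover have "((\<lambda>R. integral {0..R} (\<lambda>r. c * g r)) \<longlongrightarrow> c * integral {0..} g) at_top"
    using exp_linear_minus_power_sums(1)[OF N t, of "- \<i> * x * c"] unfolding g_def
    by (intro has_integral_atLeast_imp_tendsto has_integral_mult_right integrable_integral)
  ultimately have lim: "((\<lambda>R::real. F (c * R) - F 0) \<longlongrightarrow> c * integral {0..} g) at_top"
    by (rule Lim_transform_eventually[rotated])
  \<comment> \<open>Quadratic growth is enough: replacing N R^N by R^2 leaves a factor R in the
    lower bound for K, which cancels the R of the arc bound and still lets the quotient tend to
    0.\<close>
  define K where "K R = t * R ^ N * N / 3 - \<bar>x\<bar> * R" for R
  have K_ge: "K R \<ge> R ^ 2 * (t / 3) - \<bar>x\<bar> * R" if "R \<ge> 1" for R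
  proof -
    have "R ^ 2 * (t / 3) \<le> (R ^ N * N) * (t / 3)"
      using N t that power_increasing[of 2 N R]
      by (intro mult_right_mono order_trans[OF _ mult_left_mono[of 1 "real N"]]) auto
    then show ?thesis by (simp add: K_def algebra_simps)
  qed
  have "((\<lambda>R. F (c * R) - F (complex_of_real R)) \<longlongrightarrow> 0) at_top"
  proof (rule tendsto_norm_zero_cancel, rule tendsto_sandwich[of "\<lambda>_. 0"])
    show "((\<lambda>R. 1 / (R * (t / 3) - \<bar>x\<bar>)) \<longlongrightarrow> 0) at_top"
      using t by real_asymp
    have "eventually (\<lambda>R. R * (t / 3) - \<bar>x\<bar> > 0) at_top"
      using t by real_asymp
    then show "eventually (\<lambda>R::real. norm (F (c * R) - F (complex_of_real R)) \<le> 1 / (R * (t / 3) - \<bar>x\<bar>)) at_top"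
      using eventually_ge_at_top[of 1]
    proof eventually_elim
      case (elim R)
      have K': "K R \<ge> R * (R * (t / 3) - \<bar>x\<bar>)"
        using K_ge[OF elim(2)] by (simp add: algebra_simps power2_eq_square)
      have pos: "R * (R * (t / 3) - \<bar>x\<bar>) > 0" using elim by simp
      have K_pos: "K R > 0" using K' pos by linarith
      have "norm (F (R * c) - F R) \<le> R / K R"
        unfolding c_def
        by (rule oscillatory_primitive_arc[OF _ _ F t K_def K_pos]) (use N elim(2) in simp_all)
      also have "\<dots> \<le> R / (R * (R * (t / 3) - \<bar>x\<bar>))"
        using elim(2) by (intro divide_left_mono K' mult_pos_pos K_pos pos) simp
      also have "\<dots> = 1 / (R * (t / 3) - \<bar>x\<bar>)" using elim(2) by simp
      finally show ?case by (simp add: mult.commute)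
    qed
  qed auto
  from tendsto_diff[OF lim this] have "((\<lambda>R. F (complex_of_real R) - F 0) \<longlongrightarrow> c * integral {0..} g) at_top"
    by simp
  then show ?thesis
    unfolding g_def[abs_def] .
qed


section \<open>Identification of the coefficients\<close>

definition series_coeff :: "nat \<Rightarrow> real \<Rightarrow> nat \<Rightarrow> real" where
  "series_coeff n t j = (- 1) ^ j * sin (real n * pi * real (Suc j) / real (2 * n + 1))
     * Gamma (1 + real (Suc j) / real (2 * n + 1)) / (fact (Suc j) * root (2 * n + 1) t ^ Suc j)"

text \<open>The factor -x split off the term of index k = j + 1 cancels the prefactor -1/(pi x).
  What remains is a power series in x that is meaningful at x = 0 too.\<close>

lemma series_term_Suc: "series_term n x t (Suc j) = - x * (series_coeff n t j * x ^ j)"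
proof -
  have "(- x / root (2 * n + 1) t) ^ Suc j = - x * ((- 1) ^ j * x ^ j) / root (2 * n + 1) t ^ Suc j"
    by (simp only: power_divide power_Suc power_minus[of x j]) simp
  then show ?thesis
    unfolding series_term_def series_coeff_def
    by (simp only: times_divide_eq_left times_divide_eq_right divide_divide_eq_left mult_1_right mult_ac)
qed

text \<open>Collecting phases: (-i)^j contributes -j pi/2 and c^(j+1) contributes -\<alpha>,
  together y - j pi. The shift by j pi yields the sign (-1)^j, and cos y = sin (pi/2 + y) has the
  required argument because (N-1)/2 = n.\<close>

lemma Re_series_coeff:
  fixes n j :: nat and x t :: real
  defines "N \<equiv> 2 * n + 1" and "c \<equiv> cis (- (pi / real (2 * (2 * n + 1))))"
  shows "Re (c * ((- \<i> * x * c) ^ j / fact j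
            * complex_of_real (Gamma (real (Suc j) / N) / (N * root N t ^ Suc j))))
         = series_coeff n t j * x ^ j"
proof -
  define \<alpha> where "\<alpha> = pi * real (Suc j) / (2 * real N)"
  define y where "y = real j * (pi / 2) - \<alpha>"
  have N: "real N = 2 * real n + 1" by (simp add: N_def)
  have "c * (- \<i> * x * c) ^ j = (cis (- (pi / 2)) ^ j * c ^ Suc j) * complex_of_real (x ^ j)"
  proof -
    have i: "- \<i> = cis (- (pi / 2))" by simp
    show ?thesis
      unfolding i by (simp only: power_mult_distrib power_Suc of_real_power mult_ac)
  qed
  also have "cis (- (pi / 2)) ^ j * c ^ Suc j = cis (y - real j * pi)"
    unfolding c_def Complex.DeMoivre cis_mult
    by (rule arg_cong[of _ _ cis]) (simp add: y_def \<alpha>_def N field_simps)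
  finally have "Re (c * (- \<i> * x * c) ^ j) = cos (y - real j * pi) * x ^ j"
    by (simp add: cis.ctr)
  also have "cos (y - real j * pi) = (- 1) ^ j * cos y"
    by (simp add: cos_diff mult.commute[of _ pi])
  also have "cos y = sin (pi / 2 + y)"
    by (simp add: sin_add)
  also have "pi / 2 + y = real n * pi * real (Suc j) / real N"
    by (simp add: y_def \<alpha>_def N field_simps)
  finally have Re: "Re (c * (- \<i> * x * c) ^ j)
      = (- 1) ^ j * sin (real n * pi * real (Suc j) / real N) * x ^ j" .
  \<comment> \<open>The functional equation turns Gamma(a) / (N j!) with a = (j+1)/N into Gamma(1+a)
    / (j+1)!.\<close>
  have "Gamma (1 + real (Suc j) / N) = real (Suc j) / N * Gamma (real (Suc j) / N)"
  proof -
    have "real (Suc j) / N > 0" using N by simp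
    then have "real (Suc j) / N \<notin> \<int>\<^sub>\<le>\<^sub>0" by (meson leD nonpos_Ints_nonpos)
    from Gamma_plus1[OF this] show ?thesis by (simp only: add.commute)
  qed
  then have G: "Gamma (real (Suc j) / N) / (N * root N t ^ Suc j) / fact j
      = Gamma (1 + real (Suc j) / N) / (fact (Suc j) * root N t ^ Suc j)"
    by (simp del: of_nat_Suc power_Suc add: field_simps)
  have Re_of_real: "Re (w * complex_of_real b) = Re w * b" for w b
    by simp
  have "c * ((- \<i> * x * c) ^ j / fact j * complex_of_real (Gamma (real (Suc j) / N) / (N * root N t ^ Suc j)))
      = c * (- \<i> * x * c) ^ j * complex_of_real (Gamma (real (Suc j) / N) / (N * root N t ^ Suc j) / fact j)"
    by (simp add: mult_ac)
  then show ?thesis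
    by (simp only: G Re_of_real Re) (simp add: series_coeff_def N_def)
qed

section \<open>The integral over the whole line, and the case x = 0\<close>

lemma plane_wave_has_integral:
  fixes n :: nat and x t :: real
  assumes "n \<ge> 1" "t > 0"
  shows "summable (\<lambda>j. series_coeff n t j * x ^ j)"
    and "(plane_wave n x t has_integral complex_of_real (2 * (\<Sum>j. series_coeff n t j * x ^ j))) UNIV"
proof -
  define N where "N = 2 * n + 1"
  have N: "N \<ge> 2" "odd N" using assms by (auto simp: N_def)
  define E where "E z = exp (- \<i> * x * z - \<i> * t * z ^ N)" for z
  have "E holomorphic_on UNIV" unfolding E_def by (intro holomorphic_intros)
  then obtain F where F: "\<And>z. (F has_field_derivative E z) (at z)"
    using holomorphic_convex_primitive'[of UNIV E] by auto
  define c where "c = cis (- (pi / (2 * N)))"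
  define I where "I = integral {0..} (\<lambda>r. exp ((- \<i> * x * c) * complex_of_real r - complex_of_real (t * r ^ N)))"
  have wave: "plane_wave n x t \<beta> = E (complex_of_real \<beta>)" for \<beta>
    by (simp add: plane_wave_def E_def N_def mult_ac)
  define H where "H \<beta> = F (complex_of_real \<beta>) - F 0" for \<beta>
  have H_deriv: "(H has_vector_derivative plane_wave n x t \<beta>) (at \<beta>)" for \<beta>
    unfolding H_def wave
    by (rule has_vector_derivative_eq_rhs, rule has_vector_derivative_diff)
       (auto intro!: has_vector_derivative_real_field F)
  have lim: "(H \<longlongrightarrow> c * I) at_top"
    using oscillatory_primitive_tendsto[OF N(1) assms(2) F[unfolded E_def]]
    unfolding H_def[abs_def] I_def c_def .
  have wave_minus: "plane_wave n x t (- \<beta>) = cnj (plane_wave n x t \<beta>)" for \<beta>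
    by (simp add: plane_wave_def exp_cnj)
  \<comment> \<open>This symmetry yields the limit at -infinity without a second contour. Both sides
    have the same derivative, since the plane wave at -\<beta> is the conjugate of the one at
    \<beta>, and the normalisation H(0) = 0 fixes the constant.\<close>
  have H_minus: "H (- \<beta>) = - cnj (H \<beta>)" for \<beta>
  proof -
    have "((\<lambda>\<beta>. H (- \<beta>) + cnj (H \<beta>)) has_vector_derivative 0) (at \<beta>)" for \<beta>
    proof -
      have "((\<lambda>\<beta>. - \<beta>) has_vector_derivative (- 1)) (at \<beta>)"
        by (auto intro!: derivative_eq_intros)
      from vector_diff_chain_at[OF this H_deriv]
      have "((\<lambda>\<beta>. H (- \<beta>)) has_vector_derivative - plane_wave n x t (- \<beta>)) (at \<beta>)"
        by (simp add: o_def)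
      from has_vector_derivative_add[OF this has_vector_derivative_cnj[OF H_deriv[of \<beta>]]]
      show ?thesis by (simp add: wave_minus)
    qed
    then obtain d where "\<And>\<beta>. H (- \<beta>) + cnj (H \<beta>) = d"
      using has_vector_derivative_zero_constant[of UNIV "\<lambda>\<beta>. H (- \<beta>) + cnj (H \<beta>)"] by auto
    moreover have "H 0 = 0" by (simp add: H_def)
    ultimately have "H (- \<beta>) + cnj (H \<beta>) = 0"
      by (metis add.right_neutral complex_cnj_zero minus_zero)
    then show ?thesis
      by (simp only: eq_neg_iff_add_eq_0)
  qed
  have "((\<lambda>\<beta>. - cnj (H \<beta>)) \<longlongrightarrow> - cnj (c * I)) at_top"
    by (intro tendsto_minus tendsto_cnj lim)
  then have "(H \<longlongrightarrow> - cnj (c * I)) at_bot"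
    unfolding filterlim_at_bot_mirror H_minus .
  with H_deriv lim have "(plane_wave n x t has_integral (c * I - - cnj (c * I))) UNIV"
    by (rule has_integral_UNIV_antiderivative)
  also have "c * I - - cnj (c * I) = complex_of_real (2 * Re (c * I))"
    by (simp only: complex_add_cnj diff_minus_eq_add)
  finally have int: "(plane_wave n x t has_integral complex_of_real (2 * Re (c * I))) UNIV" .
  have "(\<lambda>j. Re (c * ((- \<i> * x * c) ^ j / fact j
           * complex_of_real (Gamma (real (Suc j) / N) / (N * root N t ^ Suc j))))) sums Re (c * I)"
    unfolding I_def by (intro sums_Re sums_mult exp_linear_minus_power_sums(2)[OF N(1) assms(2)])
  then have sums: "(\<lambda>j. series_coeff n t j * x ^ j) sums Re (c * I)"
    unfolding N_def c_def Re_series_coeff .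
  show "summable (\<lambda>j. series_coeff n t j * x ^ j)"
    by (rule sums_summable[OF sums])
  show "(plane_wave n x t has_integral complex_of_real (2 * (\<Sum>j. series_coeff n t j * x ^ j))) UNIV"
    using int by (simp only: sums_unique[OF sums])
qed

theorem theorem2p3:
  fixes n :: nat and x t :: real
  assumes "n \<ge> 1" and "t > 0"
  shows "plane_wave n x t integrable_on UNIV \<and>
    summable (\<lambda>k. series_term n x t (Suc k)) \<and>
    (x \<noteq> 0 \<longrightarrow> fundamental_solution n x t = complex_of_real (series_rhs n x t)) \<and>
    (x = 0 \<longrightarrow> ((\<lambda>y. complex_of_real (series_rhs n y t)) \<longlongrightarrow> fundamental_solution n x t) (at 0))"
proof -
  define g where "g y = (\<Sum>j. series_coeff n t j * y ^ j)" for y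
  note wave = plane_wave_has_integral[OF assms]
  \<comment> \<open>The integral formula holds at y = 0 as well, so the fundamental solution is g/pi
    everywhere.\<close>
  have fund: "fundamental_solution n y t = complex_of_real (g y / pi)" for y
    by (simp add: fundamental_solution_def integral_unique[OF wave(2)] g_def)
  \<comment> \<open>At y = 0 the convention 1/0 = 0 makes \<open>series_rhs\<close> vanish, so
    equality is claimed only away from 0; continuity of g then supplies the limit there.\<close>
  have rhs: "series_rhs n y t = g y / pi" if "y \<noteq> 0" for y
  proof -
    have "(\<Sum>k. series_term n y t (Suc k)) = - y * g y"
      unfolding series_term_Suc g_def by (rule suminf_mult[OF wave(1)])
    then show ?thesis using that by (simp add: series_rhs_def)
  qed
  have "isCont g y" for y
    unfolding g_def by (rule isCont_powser_converges_everywhere[OF wave(1)])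
  then have "((\<lambda>y. complex_of_real (g y / pi)) \<longlongrightarrow> complex_of_real (g 0 / pi)) (at 0)"
    by (intro tendsto_of_real tendsto_divide tendsto_const) (auto simp: isCont_def)
  moreover have "eventually (\<lambda>y. complex_of_real (g y / pi) = complex_of_real (series_rhs n y t)) (at 0)"
    by (auto simp: eventually_at_filter rhs)
  ultimately have "((\<lambda>y. complex_of_real (series_rhs n y t)) \<longlongrightarrow> fundamental_solution n 0 t) (at 0)"
    unfolding fund by (rule Lim_transform_eventually)
  moreover have "summable (\<lambda>k. series_term n x t (Suc k))"
    unfolding series_term_Suc by (rule summable_mult[OF wave(1)])
  ultimately show ?thesis
    using wave(2) fund rhs by auto
qed

end
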